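(* (Tarski's Axiom A in higher-order Tarski–Grothendieck set theory.) For each set $N$ there exists a set $M$ such that: (1) $N\in M$; (2) for every $X\in M$ and every $Y\subseteq X$, $Y\in M$; (3) for every $X\in M$ there is $Z\in M$ such that every $Y\subseteq X$ satisfies $Y\in Z$; (4) for every $X\subseteq M$, either there is a function $f:\iota\to\iota$ that is a bijection taking $X$ onto $M$, or $X\in M$.
   Context: The ambient theory (higher-order Tarski–Grothendieck set theory) is a classical extensional simple type theory with base type $\iota$ of sets, a choice operator at every type, and set-theoretic primitives: empty set, union, power set $\wp$, replacement $\{F x\mid x\in X\}$ for $F:\iota\to\iota$, set extensionality, $\in$-induction, and a universe operator $\mathsf{UnivOf}$ such that for every $N$: $N\in\mathsf{UnivOf}\,N$, $\mathsf{UnivOf}\,N$ is transitive and ZF-closed, and $\mathsf{UnivOf}\,N\subseteq U$ for every transitive ZF-closed $U$ with $N\in U$. (Transitive: every element is a subset. ZF-closed: closed under $\bigcup$, $\wp$, and replacement by any $F:\iota\to\iota$ mapping elements into the set.) "$f$ is a bijection taking $X$ onto $M$" means: $f u\in M$ for $u\in X$; $f$ is injective on $X$; and every element of $M$ is $f u$ for some $u\in X$. *)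

theory Defs
  imports Main
begin

text \<open>
  The ambient theory is rendered as a locale over an arbitrary type \<open>'i\<close> (the base type of sets).
  The simply typed logic, extensionality for functions and predicates, and choice at every type
  are those of HOL itself; function arguments range over the full type \<open>'i \<Rightarrow> 'i\<close>.
\<close>

definition subset_of :: "('i \<Rightarrow> 'i \<Rightarrow> bool) \<Rightarrow> 'i \<Rightarrow> 'i \<Rightarrow> bool" where
  "subset_of mem X Y \<longleftrightarrow> (\<forall>x. mem x X \<longrightarrow> mem x Y)"

definition transitive_set :: "('i \<Rightarrow> 'i \<Rightarrow> bool) \<Rightarrow> 'i \<Rightarrow> bool" where
  "transitive_set mem U \<longleftrightarrow> (\<forall>X. mem X U \<longrightarrow> subset_of mem X U)"

definition Union_closed :: "('i \<Rightarrow> 'i \<Rightarrow> bool) \<Rightarrow> ('i \<Rightarrow> 'i) \<Rightarrow> 'i \<Rightarrow> bool" where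
  "Union_closed mem UnionOf U \<longleftrightarrow> (\<forall>X. mem X U \<longrightarrow> mem (UnionOf X) U)"

definition Power_closed :: "('i \<Rightarrow> 'i \<Rightarrow> bool) \<Rightarrow> ('i \<Rightarrow> 'i) \<Rightarrow> 'i \<Rightarrow> bool" where
  "Power_closed mem PowerOf U \<longleftrightarrow> (\<forall>X. mem X U \<longrightarrow> mem (PowerOf X) U)"

definition Repl_closed ::
  "('i \<Rightarrow> 'i \<Rightarrow> bool) \<Rightarrow> ('i \<Rightarrow> ('i \<Rightarrow> 'i) \<Rightarrow> 'i) \<Rightarrow> 'i \<Rightarrow> bool" where
  "Repl_closed mem Repl U \<longleftrightarrow>
     (\<forall>X. mem X U \<longrightarrow> (\<forall>F. (\<forall>x. mem x X \<longrightarrow> mem (F x) U) \<longrightarrow> mem (Repl X F) U))"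

definition ZF_closed ::
  "('i \<Rightarrow> 'i \<Rightarrow> bool) \<Rightarrow> ('i \<Rightarrow> 'i) \<Rightarrow> ('i \<Rightarrow> 'i) \<Rightarrow> ('i \<Rightarrow> ('i \<Rightarrow> 'i) \<Rightarrow> 'i) \<Rightarrow> 'i \<Rightarrow> bool" where
  "ZF_closed mem UnionOf PowerOf Repl U \<longleftrightarrow>
     Union_closed mem UnionOf U \<and> Power_closed mem PowerOf U \<and> Repl_closed mem Repl U"

definition bijection_onto :: "('i \<Rightarrow> 'i \<Rightarrow> bool) \<Rightarrow> 'i \<Rightarrow> 'i \<Rightarrow> ('i \<Rightarrow> 'i) \<Rightarrow> bool" where
  "bijection_onto mem X M f \<longleftrightarrow>
     (\<forall>u. mem u X \<longrightarrow> mem (f u) M) \<and>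
     (\<forall>u v. mem u X \<longrightarrow> mem v X \<longrightarrow> f u = f v \<longrightarrow> u = v) \<and>
     (\<forall>w. mem w M \<longrightarrow> (\<exists>u. mem u X \<and> f u = w))"

text \<open>\<open>Repl X F\<close> is the set \<open>{F x | x \<in> X}\<close>.\<close>

locale higher_order_TG =
  fixes mem :: "'i \<Rightarrow> 'i \<Rightarrow> bool"
    and Empty :: 'i
    and UnionOf :: "'i \<Rightarrow> 'i"
    and PowerOf :: "'i \<Rightarrow> 'i"
    and Repl :: "'i \<Rightarrow> ('i \<Rightarrow> 'i) \<Rightarrow> 'i"
    and UnivOf :: "'i \<Rightarrow> 'i"
  assumes set_ext: "\<And>X Y. subset_of mem X Y \<Longrightarrow> subset_of mem Y X \<Longrightarrow> X = Y"
    and mem_induct: "\<And>P X. (\<And>X. (\<And>x. mem x X \<Longrightarrow> P x) \<Longrightarrow> P X) \<Longrightarrow> P X"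
    and Empty_ax: "\<And>x. \<not> mem x Empty"
    and Union_ax: "\<And>X x. mem x (UnionOf X) \<longleftrightarrow> (\<exists>Y. mem x Y \<and> mem Y X)"
    and Power_ax: "\<And>X Y. mem Y (PowerOf X) \<longleftrightarrow> subset_of mem Y X"
    and Repl_ax: "\<And>X F y. mem y (Repl X F) \<longleftrightarrow> (\<exists>x. mem x X \<and> y = F x)"
    and UnivOf_in: "\<And>N. mem N (UnivOf N)"
    and UnivOf_transitive: "\<And>N. transitive_set mem (UnivOf N)"
    and UnivOf_ZF_closed: "\<And>N. ZF_closed mem UnionOf PowerOf Repl (UnivOf N)"
    and UnivOf_least: "\<And>N U. mem N U \<Longrightarrow> transitive_set mem U \<Longrightarrow>
          ZF_closed mem UnionOf PowerOf Repl U \<Longrightarrow> subset_of mem (UnivOf N) U"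

end

theory Submission
  imports Defs
begin

text \<open>
  Any transitive ZF-closed set \<open>M\<close> containing \<open>N\<close> works, and only (4) needs an argument. Each set
  \<open>x\<close> lies in the power set of a level \<open>stage x\<close> of the cumulative hierarchy, and these levels are linearly
  ordered by inclusion. Ordering sets by their level and, within a level, by an arbitrary well-order
  of the universe, one obtains a well-order in which the predecessors of any element of \<open>M\<close> are
  covered by an element of \<open>M\<close>. If \<open>X \<subseteq> M\<close> is not in \<open>M\<close>, replacement shows that \<open>X\<close> is never
  exhausted by the images of such a set of predecessors, so recursion along this order yields an
  injection of \<open>M\<close> into \<open>X\<close>. Schroeder-Bernstein then gives the bijection.
\<close>

context higher_order_TG
begin

definition mem_rel :: "('i \<times> 'i) set" where
  "mem_rel = {(x, y). mem x y}"

lemma wf_mem_rel: "wf mem_rel"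
proof (rule wfUNIVI)
  fix P :: "'i \<Rightarrow> bool" and x
  assume "\<forall>x. (\<forall>y. (y, x) \<in> mem_rel \<longrightarrow> P y) \<longrightarrow> P x"
  then show "P x" using mem_induct[of P x] by (simp add: mem_rel_def)
qed

lemma subset_of_trans: "subset_of mem X Y \<Longrightarrow> subset_of mem Y Z \<Longrightarrow> subset_of mem X Z"
  by (simp add: subset_of_def)

lemma Repl_cong: "(\<And>x. mem x X \<Longrightarrow> F x = G x) \<Longrightarrow> Repl X F = Repl X G"
  by (rule set_ext) (force simp: subset_of_def Repl_ax)+

text \<open>This is the level V indexed by the rank of \<open>x\<close>, obtained by recursion on
  membership so that no ordinals have to be developed.\<close>

definition stage :: "'i \<Rightarrow> 'i" where
  "stage = wfrec mem_rel (\<lambda>V x. UnionOf (Repl x (\<lambda>y. PowerOf (V y))))"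

lemma stage_eq: "stage x = UnionOf (Repl x (\<lambda>y. PowerOf (stage y)))"
proof -
  have "stage x = UnionOf (Repl x (\<lambda>y. PowerOf (cut stage mem_rel x y)))"
    unfolding stage_def by (subst wfrec[OF wf_mem_rel]) simp
  also have "Repl x (\<lambda>y. PowerOf (cut stage mem_rel x y)) = Repl x (\<lambda>y. PowerOf (stage y))"
    by (rule Repl_cong) (simp add: cut_apply mem_rel_def)
  finally show ?thesis .
qed

lemma mem_stage_iff: "mem z (stage x) \<longleftrightarrow> (\<exists>y. mem y x \<and> subset_of mem z (stage y))"
proof -
  have "mem z (stage x) \<longleftrightarrow> (\<exists>Y. mem z Y \<and> (\<exists>y. mem y x \<and> Y = PowerOf (stage y)))"
    by (subst stage_eq) (simp only: Union_ax Repl_ax)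
  also have "\<dots> \<longleftrightarrow> (\<exists>y. mem y x \<and> mem z (PowerOf (stage y)))"
    by blast
  finally show ?thesis by (simp only: Power_ax)
qed

lemma subset_stage: "subset_of mem x (stage x)"
proof (induction x rule: mem_induct)
  case (1 x)
  then show ?case
    unfolding subset_of_def[of _ x] using mem_stage_iff by blast
qed

lemma stage_transitive: "mem u (stage x) \<Longrightarrow> subset_of mem u (stage x)"
proof (induction x arbitrary: u rule: mem_induct)
  case (1 x)
  then obtain y where y: "mem y x" "subset_of mem u (stage y)"
    using mem_stage_iff by blast
  have "mem v (stage x)" if "mem v u" for v
  proof -
    have "mem v (stage y)" using that y(2) by (simp add: subset_of_def)
    then have "subset_of mem v (stage y)" by (rule "1.IH"[OF y(1)])
    then show ?thesis using y(1) mem_stage_iff by blast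
  qed
  then show ?case by (simp add: subset_of_def)
qed

text \<open>Suppose \<open>z\<close> in \<open>stage x\<close> is missing from
  \<open>stage y\<close>, with \<open>z\<close> included in \<open>stage x'\<close> for some
  \<open>x'\<close> in \<open>x\<close>. If \<open>stage x'\<close> were included in
  \<open>stage y'\<close> for some \<open>y'\<close> in \<open>y\<close>, then \<open>z\<close>
  would enter \<open>stage y\<close>. So the induction hypothesis puts every such
  \<open>stage y'\<close> into \<open>stage x'\<close>, whence \<open>stage y\<close> is included in
  \<open>stage x'\<close> and belongs to \<open>stage x\<close>.\<close>

lemma stage_subset_or_mem:
  "subset_of mem (stage x) (stage y) \<or> mem (stage y) (stage x)"
proof (induction x arbitrary: y rule: mem_induct)
  case (1 x)
  show ?case
  proof (cases "subset_of mem (stage x) (stage y)")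
    case False
    then obtain z where z: "mem z (stage x)" "\<not> mem z (stage y)"
      by (auto simp: subset_of_def)
    then obtain x' where x': "mem x' x" "subset_of mem z (stage x')"
      by (auto simp: mem_stage_iff)
    have below: "mem (stage y') (stage x')" if "mem y' y" for y'
    proof -
      have "\<not> subset_of mem (stage x') (stage y')"
        using x'(2) z(2) that mem_stage_iff[of z y] subset_of_trans by blast
      then show ?thesis using 1[OF x'(1)] by blast
    qed
    have "subset_of mem (stage y) (stage x')"
      unfolding subset_of_def[of _ "stage y"]
    proof (intro allI impI)
      fix u assume "mem u (stage y)"
      then obtain y' where "mem y' y" "subset_of mem u (stage y')"
        using mem_stage_iff by blast
      then show "mem u (stage x')"
        using below[of y'] mem_stage_iff[of _ x'] subset_of_trans by blast
    qed
    then show ?thesis using x'(1) by (auto simp: mem_stage_iff)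
  qed simp
qed

lemma stage_trichotomy:
  "mem (stage x) (stage y) \<or> stage x = stage y \<or> mem (stage y) (stage x)"
  using stage_subset_or_mem set_ext by blast

text \<open>Levels are compared by membership, so well-foundedness comes from
  \<open>wf_mem_rel\<close>; removing \<open>Id\<close> makes the chosen well-order, which breaks
  ties within a level, strict.\<close>

definition stage_less :: "('i \<times> 'i) set" where
  "stage_less = inv_image (mem_rel <*lex*> ((SOME r. Well_order r \<and> Field r = UNIV) - Id))
     (\<lambda>x. (stage x, x))"

lemma wf_stage_less: "wf stage_less"
  and stage_less_total: "x \<noteq> y \<Longrightarrow> (x, y) \<in> stage_less \<or> (y, x) \<in> stage_less"
proof -
  define w :: "('i \<times> 'i) set" where "w = (SOME r. Well_order r \<and> Field r = UNIV)"
  have "Well_order w \<and> Field w = UNIV"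
    unfolding w_def by (rule someI_ex) (rule well_ordering)
  then have w: "wf (w - Id)" "total w"
    by (auto simp: well_order_on_def linear_order_on_def)
  show "wf stage_less"
    unfolding stage_less_def w_def[symmetric]
    by (intro wf_inv_image wf_lex_prod wf_mem_rel w)
  show "(x, y) \<in> stage_less \<or> (y, x) \<in> stage_less" if "x \<noteq> y"
    using stage_trichotomy[of x y] w(2) that
    unfolding stage_less_def w_def[symmetric]
    by (auto simp: mem_rel_def total_on_def)
qed

text \<open>Bounds the predecessors of \<open>x\<close> by a single set, to which replacement can be
  applied; for \<open>x\<close> in a universe this bound lies in the universe too.\<close>

lemma stage_less_imp_mem_Power:
  assumes "(y, x) \<in> stage_less"
  shows "mem y (PowerOf (stage x))"
proof -
  have "subset_of mem (stage y) (stage x)"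
    using assms stage_transitive[of "stage y" x]
    by (auto simp: stage_less_def mem_rel_def subset_of_def)
  then show ?thesis
    using subset_of_trans[OF subset_stage] by (simp add: Power_ax)
qed

end

locale TG_universe = higher_order_TG +
  fixes M
  assumes trans: "transitive_set mem M"
    and closed: "ZF_closed mem UnionOf PowerOf Repl M"
begin

lemma Power_in: "mem X M \<Longrightarrow> mem (PowerOf X) M"
  using closed by (auto simp: ZF_closed_def Power_closed_def)

lemma Union_in: "mem X M \<Longrightarrow> mem (UnionOf X) M"
  using closed by (auto simp: ZF_closed_def Union_closed_def)

lemma Repl_in: "mem X M \<Longrightarrow> (\<And>x. mem x X \<Longrightarrow> mem (F x) M) \<Longrightarrow> mem (Repl X F) M"
  using closed by (auto simp: ZF_closed_def Repl_closed_def)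

lemma mem_in: "mem x X \<Longrightarrow> mem X M \<Longrightarrow> mem x M"
  using trans by (auto simp: transitive_set_def subset_of_def)

lemma subset_in: "subset_of mem Y X \<Longrightarrow> mem X M \<Longrightarrow> mem Y M"
  using Power_in mem_in Power_ax by blast

lemma stage_in: "mem x M \<Longrightarrow> mem (stage x) M"
proof (induction x rule: mem_induct)
  case (1 x)
  have "mem (PowerOf (stage y)) M" if "mem y x" for y
    using that mem_in[OF that "1.prems"] by (intro Power_in "1.IH")
  then show ?case
    by (subst stage_eq) (intro Union_in Repl_in "1.prems")
qed

lemma injection_into_large_subset:
  assumes XM: "subset_of mem X M" and X: "\<not> mem X M"
  obtains f where "\<And>x. mem x M \<Longrightarrow> mem (f x) X" "inj_on f {x. mem x M}"
proof -
  define fresh where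
    "fresh g x = (SOME z. mem z X \<and> (\<forall>y. mem y M \<longrightarrow> (y, x) \<in> stage_less \<longrightarrow> z \<noteq> g y))" for g x
  define f where "f = wfrec stage_less fresh"
  have f_eq: "f x = fresh f x" for x
  proof -
    have "f x = fresh (cut f stage_less x) x"
      unfolding f_def by (rule wfrec[OF wf_stage_less])
    \<comment> \<open>\<open>fresh\<close> consults its function only at predecessors of
      \<open>x\<close>, where the cut agrees with \<open>f\<close>.\<close>
    also have "\<dots> = fresh f x"
      unfolding fresh_def by (rule arg_cong[where f = Eps]) (auto simp: cut_apply)
    finally show ?thesis .
  qed
  have f: "mem (f x) X \<and> (\<forall>y. mem y M \<longrightarrow> (y, x) \<in> stage_less \<longrightarrow> f x \<noteq> f y)"
    if "mem x M" for x
    using wf_stage_less that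
  proof (induction x rule: wf_induct_rule)
    case (less x)
    \<comment> \<open>\<open>PowerOf (stage x)\<close> may contain more than predecessors of
      \<open>x\<close>. The default \<open>x\<close>, itself in \<open>M\<close>, keeps all values
      of \<open>F\<close> in \<open>M\<close>; at predecessors in \<open>M\<close> the induction
      hypothesis puts \<open>f y\<close> into \<open>X\<close>, hence into \<open>M\<close>.\<close>
    define F where "F y = (if mem y M \<and> (y, x) \<in> stage_less then f y else x)" for y
    have "mem (Repl (PowerOf (stage x)) F) M"
    proof (rule Repl_in)
      show "mem (PowerOf (stage x)) M" by (intro Power_in stage_in less.prems)
      show "mem (F y) M" for y
        using less XM by (auto simp: F_def subset_of_def)
    qed
    \<comment> \<open>Otherwise \<open>X\<close> would be a subset of an element of
      \<open>M\<close>, hence in \<open>M\<close>. So some \<open>z\<close> in \<open>X\<close>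
      avoids all earlier values, and the choice in \<open>fresh\<close> is legitimate.\<close>
    then have "\<not> subset_of mem X (Repl (PowerOf (stage x)) F)"
      using X subset_in by blast
    then obtain z where z: "mem z X" "\<not> mem z (Repl (PowerOf (stage x)) F)"
      by (auto simp: subset_of_def)
    have "z \<noteq> f y" if "mem y M" "(y, x) \<in> stage_less" for y
    proof
      assume "z = f y"
      then have "z = F y" using that by (simp add: F_def)
      then show False
        using z(2) stage_less_imp_mem_Power[OF that(2)] Repl_ax by blast
    qed
    with z(1) have "\<exists>z. mem z X \<and> (\<forall>y. mem y M \<longrightarrow> (y, x) \<in> stage_less \<longrightarrow> z \<noteq> f y)"
      by blast
    from someI_ex[OF this] show ?case
      unfolding f_eq[of x] fresh_def .
  qed
  show thesis
  proof
    show "mem (f x) X" if "mem x M" for x using f[OF that] by blast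
    show "inj_on f {x. mem x M}"
    proof (rule inj_onI)
      fix x y assume "x \<in> {x. mem x M}" "y \<in> {x. mem x M}" "f x = f y"
      \<comment> \<open>Of two distinct elements, one precedes the other, and the later value was
        chosen to differ from the earlier one.\<close>
      then show "x = y"
        using f[of x] f[of y] stage_less_total[of x y] by (metis mem_Collect_eq)
    qed
  qed
qed

lemma bijection_or_in:
  assumes XM: "subset_of mem X M"
  shows "(\<exists>f. bijection_onto mem X M f) \<or> mem X M"
proof (cases "mem X M")
  case False
  then obtain g where g: "\<And>x. mem x M \<Longrightarrow> mem (g x) X" "inj_on g {x. mem x M}"
    using injection_into_large_subset[OF XM] by blast
  have "\<exists>h. bij_betw h {x. mem x X} {x. mem x M}"
    by (rule Schroeder_Bernstein[of id _ _ g]) (use g XM in \<open>auto simp: subset_of_def\<close>)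
  then obtain h where h: "bij_betw h {x. mem x X} {x. mem x M}" ..
  have "bijection_onto mem X M h"
    unfolding bijection_onto_def
  proof (intro conjI allI impI)
    show "mem (h u) M" if "mem u X" for u
      using bij_betw_apply[OF h, of u] that by simp
    show "u = v" if "mem u X" "mem v X" "h u = h v" for u v
      using inj_onD[OF bij_betw_imp_inj_on[OF h] that(3)] that by simp
    show "\<exists>u. mem u X \<and> h u = w" if "mem w M" for w
    proof -
      have "w \<in> h ` {x. mem x X}"
        using that bij_betw_imp_surj_on[OF h] by simp
      then show ?thesis by auto
    qed
  qed
  then show ?thesis by blast
qed simp

end

theorem theorem5:
  fixes mem :: "'i \<Rightarrow> 'i \<Rightarrow> bool"
    and Empty :: 'i
    and UnionOf PowerOf :: "'i \<Rightarrow> 'i"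
    and Repl :: "'i \<Rightarrow> ('i \<Rightarrow> 'i) \<Rightarrow> 'i"
    and UnivOf :: "'i \<Rightarrow> 'i"
  assumes "higher_order_TG mem Empty UnionOf PowerOf Repl UnivOf"
  shows "\<forall>N. \<exists>M.
      mem N M \<and>
      (\<forall>X. mem X M \<longrightarrow> (\<forall>Y. subset_of mem Y X \<longrightarrow> mem Y M)) \<and>
      (\<forall>X. mem X M \<longrightarrow> (\<exists>Z. mem Z M \<and> (\<forall>Y. subset_of mem Y X \<longrightarrow> mem Y Z))) \<and>
      (\<forall>X. subset_of mem X M \<longrightarrow>
         (\<exists>f :: 'i \<Rightarrow> 'i. bijection_onto mem X M f) \<or> mem X M)"
proof
  fix N
  interpret higher_order_TG mem Empty UnionOf PowerOf Repl UnivOf by (fact assms)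
  interpret TG_universe mem Empty UnionOf PowerOf Repl UnivOf "UnivOf N"
    by unfold_locales (rule UnivOf_transitive UnivOf_ZF_closed)+
  show "\<exists>M. mem N M \<and>
      (\<forall>X. mem X M \<longrightarrow> (\<forall>Y. subset_of mem Y X \<longrightarrow> mem Y M)) \<and>
      (\<forall>X. mem X M \<longrightarrow> (\<exists>Z. mem Z M \<and> (\<forall>Y. subset_of mem Y X \<longrightarrow> mem Y Z))) \<and>
      (\<forall>X. subset_of mem X M \<longrightarrow>
         (\<exists>f :: 'i \<Rightarrow> 'i. bijection_onto mem X M f) \<or> mem X M)"
  proof (rule exI[of _ "UnivOf N"], intro conjI allI impI)
    show "mem N (UnivOf N)" by (rule UnivOf_in)
    show "mem Y (UnivOf N)" if "mem X (UnivOf N)" "subset_of mem Y X" for X Y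
      using that subset_in by blast
    show "\<exists>Z. mem Z (UnivOf N) \<and> (\<forall>Y. subset_of mem Y X \<longrightarrow> mem Y Z)"
      if "mem X (UnivOf N)" for X
      using Power_in[OF that] Power_ax by blast
    show "(\<exists>f. bijection_onto mem X (UnivOf N) f) \<or> mem X (UnivOf N)"
      if "subset_of mem X (UnivOf N)" for X
      using that by (rule bijection_or_in)
  qed
qed

end
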